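(* Let $T$ be a positive, densely defined closed operator in $H$. Then the following are equivalent: (1) $T$ is minimum attaining; (2) $m(T)\in\sigma_p(T)$; (3) $m(T)$ is an extreme point of the numerical range $W(T)$.
   Context: $H$ is an infinite dimensional complex Hilbert space. A densely defined closed operator $T$ in $H$ is positive if it is self-adjoint and $\langle Tx,x\rangle\ge0$ for all $x\in D(T)$. The minimum modulus is $m(T)=\inf\{\|Tx\|: x\in D(T),\ \|x\|=1\}$, and $T$ is minimum attaining if there is $x_0\in D(T)$ with $\|x_0\|=1$ and $\|Tx_0\|=m(T)$. $\sigma_p(T)$ is the set of eigenvalues of $T$, and $W(T)=\{\langle Tx,x\rangle: x\in D(T),\ \|x\|=1\}$. An extreme point of $W(T)$ is in particular an element of $W(T)$. *)

theory Defs
  imports "HOL-Analysis.Analysis"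
begin

text \<open>Complex Hilbert spaces. The inner product is linear in its first argument; completeness and
  the real structure come from the class banach, and the norm is the one induced by the inner
  product.\<close>

class chilbert_space = banach +
  fixes scaleC :: "complex \<Rightarrow> 'a \<Rightarrow> 'a" (infixr \<open>*\<^sub>C\<close> 75)
    and cinner :: "'a \<Rightarrow> 'a \<Rightarrow> complex"
  assumes scaleC_add_right: "a *\<^sub>C (x + y) = a *\<^sub>C x + a *\<^sub>C y"
    and scaleC_add_left: "(a + b) *\<^sub>C x = a *\<^sub>C x + b *\<^sub>C x"
    and scaleC_scaleC: "a *\<^sub>C b *\<^sub>C x = (a * b) *\<^sub>C x"
    and scaleC_one: "1 *\<^sub>C x = x"
    and scaleR_scaleC: "r *\<^sub>R x = complex_of_real r *\<^sub>C x"
    and cinner_commute: "cinner x y = cnj (cinner y x)"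
    and cinner_add_left: "cinner (x + y) z = cinner x z + cinner y z"
    and cinner_scaleC_left: "cinner (a *\<^sub>C x) y = a * cinner x y"
    and cinner_ge_zero: "cinner x x \<in> \<real>\<^sub>\<ge>\<^sub>0"
    and cinner_eq_zero_iff: "cinner x x = 0 \<longleftrightarrow> x = 0"
    and norm_eq_sqrt_cinner: "norm x = sqrt (Re (cinner x x))"

global_interpretation cvec: vector_space "scaleC :: complex \<Rightarrow> 'a \<Rightarrow> 'a::chilbert_space"
  by standard (rule scaleC_add_right scaleC_add_left scaleC_scaleC scaleC_one)+

definition infinite_dimensional :: "'a::chilbert_space itself \<Rightarrow> bool" where
  "infinite_dimensional _ \<longleftrightarrow> \<not> (\<exists>B :: 'a set. finite B \<and> cvec.span B = UNIV)"

text \<open>An operator in \<open>H\<close> is a partial function \<open>T\<close> whose domain \<open>D(T)\<close> is \<open>dom T\<close>, so that equality of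
  operators includes equality of their domains. For \<open>x \<in> dom T\<close> the value is \<open>T \<bullet>\<^sub>o x\<close>.\<close>

type_synonym 'a operator = "'a \<Rightarrow> 'a option"

abbreviation op_app :: "'a operator \<Rightarrow> 'a \<Rightarrow> 'a" (infixl \<open>\<bullet>\<^sub>o\<close> 80) where
  "T \<bullet>\<^sub>o x \<equiv> the (T x)"

definition linear_operator :: "'a::chilbert_space operator \<Rightarrow> bool" where
  "linear_operator T \<longleftrightarrow> cvec.subspace (dom T) \<and>
     (\<forall>x\<in>dom T. \<forall>y\<in>dom T. T \<bullet>\<^sub>o (x + y) = T \<bullet>\<^sub>o x + T \<bullet>\<^sub>o y) \<and>
     (\<forall>c. \<forall>x\<in>dom T. T \<bullet>\<^sub>o (c *\<^sub>C x) = c *\<^sub>C (T \<bullet>\<^sub>o x))"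

definition densely_defined :: "'a::chilbert_space operator \<Rightarrow> bool" where
  "densely_defined T \<longleftrightarrow> closure (dom T) = UNIV"

definition closed_operator :: "'a::chilbert_space operator \<Rightarrow> bool" where
  "closed_operator T \<longleftrightarrow> closed {(x, T \<bullet>\<^sub>o x) |x. x \<in> dom T}"

text \<open>The adjoint; the vector \<open>z\<close> is unique when \<open>T\<close> is densely defined, which is the only case used.\<close>

definition adjoint_op :: "'a::chilbert_space operator \<Rightarrow> 'a operator" where
  "adjoint_op T = (\<lambda>y.
     if \<exists>z. \<forall>x\<in>dom T. cinner (T \<bullet>\<^sub>o x) y = cinner x z
     then Some (THE z. \<forall>x\<in>dom T. cinner (T \<bullet>\<^sub>o x) y = cinner x z)
     else None)"

definition self_adjoint :: "'a::chilbert_space operator \<Rightarrow> bool" where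
  "self_adjoint T \<longleftrightarrow> adjoint_op T = T"

definition positive_operator :: "'a::chilbert_space operator \<Rightarrow> bool" where
  "positive_operator T \<longleftrightarrow> self_adjoint T \<and> (\<forall>x\<in>dom T. cinner (T \<bullet>\<^sub>o x) x \<in> \<real>\<^sub>\<ge>\<^sub>0)"

definition min_modulus :: "'a::chilbert_space operator \<Rightarrow> real" where
  "min_modulus T = Inf {norm (T \<bullet>\<^sub>o x) |x. x \<in> dom T \<and> norm x = 1}"

definition minimum_attaining :: "'a::chilbert_space operator \<Rightarrow> bool" where
  "minimum_attaining T \<longleftrightarrow> (\<exists>x\<in>dom T. norm x = 1 \<and> norm (T \<bullet>\<^sub>o x) = min_modulus T)"

definition point_spectrum :: "'a::chilbert_space operator \<Rightarrow> complex set" where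
  "point_spectrum T = {c. \<exists>x\<in>dom T. x \<noteq> 0 \<and> T \<bullet>\<^sub>o x = c *\<^sub>C x}"

definition numerical_range :: "'a::chilbert_space operator \<Rightarrow> complex set" where
  "numerical_range T = {cinner (T \<bullet>\<^sub>o x) x |x. x \<in> dom T \<and> norm x = 1}"

end

theory Submission
  imports Defs
begin

text \<open>Everything rests on the inequality \<open>Re \<langle>Tx,x\<rangle> \<ge> m(T) \<parallel>x\<parallel>\<^sup>2\<close>. If \<open>m(T) > 0\<close>, then self-adjointness makes
  the range of \<open>T\<close> dense, so \<open>x\<close> is a limit of vectors \<open>Tw\<close>; Cauchy--Schwarz for the form
  \<open>\<langle>Tw,x\<rangle>\<close> gives \<open>(Re \<langle>Tw,x\<rangle>)\<^sup>2 \<le> \<langle>Tw,w\<rangle> \<langle>Tx,x\<rangle> \<le> \<parallel>Tw\<parallel>\<^sup>2 / m(T) \<cdot> \<langle>Tx,x\<rangle>\<close>, and one lets \<open>Tw\<close> tend to \<open>x\<close>.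
  Given the inequality, a unit vector with \<open>\<parallel>Tx\<parallel> = m(T)\<close> satisfies \<open>\<parallel>Tx - m(T)x\<parallel>\<^sup>2 \<le> 0\<close>; and a unit
  vector with \<open>\<langle>Tx,x\<rangle> = m(T)\<close> is isotropic for the positive form of \<open>T - m(T)\<close>, hence in its kernel.
  Since \<open>W(T)\<close> lies in the real half-line starting at \<open>m(T)\<close>, that point is extreme as soon as it
  belongs to \<open>W(T)\<close>.\<close>

section \<open>Cauchy--Schwarz for positive semidefinite forms\<close>

lemma nonneg_quadratic_discriminant:
  fixes a b c :: real
  assumes nonneg: "\<And>t. 0 \<le> a + 2 * t * b + t\<^sup>2 * c"
  shows "b\<^sup>2 \<le> a * c"
proof (cases "c = 0")
  case True
  have "b = 0"
  proof (rule ccontr)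
    assume "b \<noteq> 0"
    \<comment> \<open>With \<open>c = 0\<close> this \<open>t\<close> gives the polynomial the value
      -1.\<close>
    then show False using nonneg[of "- (a + 1) / (2 * b)"] True by (simp add: field_simps)
  qed
  then show ?thesis using True by simp
next
  case False
  have "0 \<le> c"
  proof (rule ccontr)
    assume "\<not> 0 \<le> c"
    then have c: "c < 0" by simp
    \<comment> \<open>Chosen so that \<open>t\<^sup>2 * c = - (\<bar>a\<bar> + 1)\<close>; adding
      the values at \<open>t\<close> and \<open>- t\<close> cancels the linear term and leaves a
      negative sum.\<close>
    define t where "t = sqrt ((\<bar>a\<bar> + 1) / - c)"
    have "t\<^sup>2 = (\<bar>a\<bar> + 1) / - c" unfolding t_def
      using c by (intro real_sqrt_pow2 divide_nonneg_nonneg) auto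
    then have "t\<^sup>2 * c = - (\<bar>a\<bar> + 1)" using c by simp
    then show False using nonneg[of t] nonneg[of "- t"] by simp
  qed
  then have c: "0 < c" using False by simp
  \<comment> \<open>For \<open>c > 0\<close> the quadratic is minimal at
    \<open>- b / c\<close>.\<close>
  have "0 \<le> (a + 2 * (- b / c) * b + (- b / c)\<^sup>2 * c) * c"
    using nonneg[of "- b / c"] c by simp
  also have "\<dots> = a * c - b\<^sup>2"
    using c by (simp add: field_simps power2_eq_square)
  finally show ?thesis by simp
qed

text \<open>The discriminant bound applied to \<open>t \<mapsto> B (x + t y) (x + t y)\<close>. The
  form is only semidefinite and lives on a subspace, so that forms of unbounded operators are
  covered.\<close>

lemma form_cauchy_schwarz:
  fixes B :: "'a::real_vector \<Rightarrow> 'a \<Rightarrow> real"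
  assumes D: "subspace D"
    and add: "\<And>x y z. x \<in> D \<Longrightarrow> y \<in> D \<Longrightarrow> z \<in> D \<Longrightarrow> B (x + y) z = B x z + B y z"
    and scale: "\<And>r x y. x \<in> D \<Longrightarrow> y \<in> D \<Longrightarrow> B (r *\<^sub>R x) y = r * B x y"
    and sym: "\<And>x y. x \<in> D \<Longrightarrow> y \<in> D \<Longrightarrow> B x y = B y x"
    and nonneg: "\<And>x. x \<in> D \<Longrightarrow> 0 \<le> B x x"
    and xy: "x \<in> D" "y \<in> D"
  shows "(B x y)\<^sup>2 \<le> B x x * B y y"
proof (rule nonneg_quadratic_discriminant)
  fix t :: real
  have ty: "t *\<^sub>R y \<in> D" and s: "x + t *\<^sub>R y \<in> D"
    using D xy by (auto intro: subspace_add subspace_scale)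
  have right: "B u (x + t *\<^sub>R y) = B u x + t * B u y" if "u \<in> D" for u
    using that xy ty s add[of x "t *\<^sub>R y" u] scale[of y u t]
    by (simp add: sym[of u])
  have "B (x + t *\<^sub>R y) (x + t *\<^sub>R y) = B x x + 2 * t * B x y + t\<^sup>2 * B y y"
    using xy ty s sym[of y x]
    by (simp add: add scale right algebra_simps power2_eq_square)
  then show "0 \<le> B x x + 2 * t * B x y + t\<^sup>2 * B y y"
    using nonneg[OF s] by simp
qed

section \<open>The real inner product\<close>

abbreviation rinner :: "'a::chilbert_space \<Rightarrow> 'a \<Rightarrow> real" where
  "rinner x y \<equiv> Re (cinner x y)"

lemma rinner_commute: "rinner x y = rinner y x"
  by (subst cinner_commute) simp

lemma rinner_add_left: "rinner (x + y) z = rinner x z + rinner y z"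
  by (simp add: cinner_add_left)

lemma rinner_add_right: "rinner z (x + y) = rinner z x + rinner z y"
  by (metis rinner_add_left rinner_commute)

lemma rinner_scaleR_left: "rinner (r *\<^sub>R x) y = r * rinner x y"
  by (simp add: scaleR_scaleC cinner_scaleC_left)

lemma rinner_scaleR_right: "rinner x (r *\<^sub>R y) = r * rinner x y"
  by (metis rinner_scaleR_left rinner_commute)

lemma rinner_diff_left: "rinner (x - y) z = rinner x z - rinner y z"
  using rinner_add_left[of "x - y" y z] by simp

lemma rinner_diff_right: "rinner z (x - y) = rinner z x - rinner z y"
  by (metis rinner_diff_left rinner_commute)

lemmas rinner_simps = rinner_add_left rinner_add_right rinner_scaleR_left rinner_scaleR_right
  rinner_diff_left rinner_diff_right

lemma rinner_self: "rinner x x = (norm x)\<^sup>2"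
  using cinner_ge_zero[of x] by (simp add: norm_eq_sqrt_cinner complex_nonneg_Reals_iff)

lemma norm_add_sq: "(norm (x + y :: 'a::chilbert_space))\<^sup>2 = (norm x)\<^sup>2 + 2 * rinner x y + (norm y)\<^sup>2"
  using rinner_commute[of y x] by (simp flip: rinner_self add: rinner_simps)

lemma norm_diff_sq: "(norm (x - y :: 'a::chilbert_space))\<^sup>2 = (norm x)\<^sup>2 - 2 * rinner x y + (norm y)\<^sup>2"
  using rinner_commute[of y x] by (simp flip: rinner_self add: rinner_simps)

lemma rinner_cauchy_schwarz: "\<bar>rinner x y\<bar> \<le> norm x * norm y"
proof -
  have "(rinner x y)\<^sup>2 \<le> rinner x x * rinner y y"
    by (rule form_cauchy_schwarz[where D = UNIV and B = rinner])
      (simp_all add: rinner_simps rinner_self, rule rinner_commute)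
  then show ?thesis
    by - (rule power2_le_imp_le, simp_all add: rinner_self power_mult_distrib)
qed

lemma bounded_bilinear_rinner: "bounded_bilinear (rinner :: 'a::chilbert_space \<Rightarrow> 'a \<Rightarrow> real)"
  by (rule bounded_bilinear.intro)
    (auto simp: rinner_simps intro!: exI[of _ 1] rinner_cauchy_schwarz)

lemmas tendsto_rinner = bounded_bilinear.tendsto[OF bounded_bilinear_rinner]

section \<open>Density and orthogonality\<close>

lemma cvec_subspace_imp_subspace: "cvec.subspace S \<Longrightarrow> subspace S"
  unfolding cvec.subspace_def subspace_def by (simp add: scaleR_scaleC)

text \<open>By continuity \<open>z\<close> is orthogonal to the closure, hence to itself.\<close>

lemma eq_zero_if_rinner_zero_on_dense:
  assumes dense: "closure S = UNIV" and orth: "\<And>x. x \<in> S \<Longrightarrow> rinner x z = 0"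
  shows "z = 0"
proof -
  obtain f where f: "\<And>n::nat. f n \<in> S" "f \<longlonglongrightarrow> z"
    using dense closure_sequential[of z S] by auto
  have "(\<lambda>n. rinner (f n) z) \<longlonglongrightarrow> rinner z z"
    by (rule tendsto_rinner[OF f(2) tendsto_const])
  then have "rinner z z = 0" by (simp add: orth[OF f(1)] LIMSEQ_const_iff)
  then show ?thesis by (simp add: rinner_self)
qed

text \<open>The residual \<open>z\<close> of a minimizing sequence for the distance from \<open>x\<close> to \<open>M\<close> is orthogonal
  to \<open>M\<close>; the sequence converges by the parallelogram law.\<close>

lemma dense_if_orthogonal_trivial:
  fixes M :: "'a::chilbert_space set"
  assumes M: "subspace M" and orth: "\<And>z. (\<And>u. u \<in> M \<Longrightarrow> rinner u z = 0) \<Longrightarrow> z = 0"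
  shows "closure M = UNIV"
proof -
  have "x \<in> closure M" for x
  proof -
    define d where "d = (INF y\<in>M. (norm (x - y))\<^sup>2)"
    have bdd: "bdd_below ((\<lambda>y. (norm (x - y))\<^sup>2) ` M)"
      by (auto intro!: bdd_belowI[of _ 0])
    have ne: "M \<noteq> {}" using subspace_0[OF M] by auto
    have d_le: "d \<le> (norm (x - y))\<^sup>2" if "y \<in> M" for y
      unfolding d_def by (rule cINF_lower[OF bdd that])
    have "\<exists>y\<in>M. (norm (x - y))\<^sup>2 < d + inverse (real (Suc n))" for n
      unfolding d_def using cINF_less_iff[OF ne bdd]
      by (metis less_add_same_cancel1 inverse_positive_iff_positive of_nat_0_less_iff zero_less_Suc)
    then obtain f where f: "\<And>n. f n \<in> M"
      and f_less: "\<And>n. (norm (x - f n))\<^sup>2 < d + inverse (real (Suc n))"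
      by metis
    have gap: "(norm (f n - f k))\<^sup>2 \<le> 2 * inverse (real (Suc n)) + 2 * inverse (real (Suc k))" for n k
    proof -
      \<comment> \<open>The midpoint competes in the infimum, which bounds the sum term of the
        parallelogram law below by \<open>4 * d\<close>.\<close>
      have "(1/2) *\<^sub>R (f n + f k) \<in> M"
        using M f by (intro subspace_scale subspace_add)
      from d_le[OF this]
      have "4 * d \<le> 4 * (norm (x - (1/2) *\<^sub>R (f n + f k)))\<^sup>2" by simp
      also have "\<dots> = (norm ((x - f n) + (x - f k)))\<^sup>2"
      proof -
        have "(x - f n) + (x - f k) = 2 *\<^sub>R (x - (1/2) *\<^sub>R (f n + f k))"
          by (simp add: algebra_simps scaleR_2)
        then show ?thesis by (simp add: power_mult_distrib)
      qed
      finally have "4 * d \<le> (norm ((x - f n) + (x - f k)))\<^sup>2" .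
      moreover have "(norm (f n - f k))\<^sup>2 = (norm ((x - f k) - (x - f n)))\<^sup>2" by simp
      ultimately show ?thesis
        using f_less[of n] f_less[of k] rinner_commute[of "x - f k" "x - f n"]
        unfolding norm_add_sq norm_diff_sq by linarith
    qed
    have "Cauchy f"
    proof (rule metric_CauchyI)
      fix e :: real assume e: "0 < e"
      \<comment> \<open>Each of the two terms in \<open>gap\<close> then stays below
        \<open>e\<^sup>2 / 2\<close>.\<close>
      obtain N where N: "inverse (real (Suc N)) < e\<^sup>2 / 4"
        using reals_Archimedean[of "e\<^sup>2 / 4"] e by auto
      have "dist (f m) (f n) < e" if "m \<ge> N" "n \<ge> N" for m n
      proof -
        have "inverse (real (Suc m)) \<le> inverse (real (Suc N))"
          "inverse (real (Suc n)) \<le> inverse (real (Suc N))"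
          using that by (auto intro!: le_imp_inverse_le)
        then have "(norm (f m - f n))\<^sup>2 < e\<^sup>2"
          using gap[of m n] N by linarith
        then show ?thesis using e by (simp add: dist_norm power2_less_imp_less)
      qed
      then show "\<exists>N. \<forall>m\<ge>N. \<forall>n\<ge>N. dist (f m) (f n) < e" by blast
    qed
    then obtain y where y: "f \<longlonglongrightarrow> y"
      using convergent_eq_Cauchy by blast
    define z where "z = x - y"
    have z_le: "(norm z)\<^sup>2 \<le> d"
    proof (rule LIMSEQ_le)
      show "(\<lambda>n. (norm (x - f n))\<^sup>2) \<longlonglongrightarrow> (norm z)\<^sup>2"
        unfolding z_def by (intro tendsto_intros y)
      show "(\<lambda>n. d + inverse (real (Suc n))) \<longlonglongrightarrow> d"
        using tendsto_add[OF tendsto_const LIMSEQ_inverse_real_of_nat, of d] by simp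
      show "\<exists>N. \<forall>n\<ge>N. (norm (x - f n))\<^sup>2 \<le> d + inverse (real (Suc n))"
        using f_less less_imp_le by blast
    qed
    have z_min: "d \<le> (norm (z + v))\<^sup>2" if v: "v \<in> M" for v
    proof (rule LIMSEQ_le_const)
      show "(\<lambda>n. (norm (x - f n + v))\<^sup>2) \<longlonglongrightarrow> (norm (z + v))\<^sup>2"
        unfolding z_def by (intro tendsto_intros y)
      have "d \<le> (norm (x - f n + v))\<^sup>2" for n
        using d_le[of "f n - v"] f v M by (simp add: subspace_diff algebra_simps)
      then show "\<exists>N. \<forall>n\<ge>N. d \<le> (norm (x - f n + v))\<^sup>2" by blast
    qed
    have "z = 0"
    proof (rule orth)
      fix u assume u: "u \<in> M"
      \<comment> \<open>The quadratic \<open>(norm (z + t u))\<^sup>2 - (norm z)\<^sup>2\<close> in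
        \<open>t\<close> is nonnegative with constant term 0, so its linear coefficient
        vanishes.\<close>
      have "(rinner z u)\<^sup>2 \<le> 0 * (norm u)\<^sup>2"
      proof (rule nonneg_quadratic_discriminant)
        fix t :: real
        have "(norm z)\<^sup>2 \<le> (norm (z + t *\<^sub>R u))\<^sup>2"
          using z_le z_min[OF subspace_scale[OF M u]] order_trans by blast
        then show "0 \<le> 0 + 2 * t * rinner z u + t\<^sup>2 * (norm u)\<^sup>2"
          by (simp add: norm_add_sq rinner_simps power_mult_distrib)
      qed
      then show "rinner u z = 0" by (simp add: rinner_commute[of u])
    qed
    then show ?thesis
      using f y closure_sequential z_def by (metis eq_iff_diff_eq_0)
  qed
  then show ?thesis by blast
qed

section \<open>Self-adjoint positive operators and their forms\<close>

context
  fixes T :: "'a::chilbert_space operator"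
  assumes lin: "linear_operator T" and dense: "densely_defined T" and pos: "positive_operator T"
begin

lemma dom_subspace: "subspace (dom T)"
  using lin cvec_subspace_imp_subspace unfolding linear_operator_def by blast

lemma op_add: "x \<in> dom T \<Longrightarrow> y \<in> dom T \<Longrightarrow> T \<bullet>\<^sub>o (x + y) = T \<bullet>\<^sub>o x + T \<bullet>\<^sub>o y"
  using lin unfolding linear_operator_def by blast

lemma op_scaleR: "x \<in> dom T \<Longrightarrow> T \<bullet>\<^sub>o (r *\<^sub>R x) = r *\<^sub>R (T \<bullet>\<^sub>o x)"
  using lin unfolding linear_operator_def by (simp add: scaleR_scaleC)

lemma adjoint_unique:
  assumes "\<forall>x\<in>dom T. cinner (T \<bullet>\<^sub>o x) y = cinner x z" "\<forall>x\<in>dom T. cinner (T \<bullet>\<^sub>o x) y = cinner x z'"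
  shows "z = z'"
proof -
  have "z - z' = 0"
    using dense assms unfolding densely_defined_def
    by (intro eq_zero_if_rinner_zero_on_dense[of "dom T"]) (auto simp: rinner_simps)
  then show ?thesis by simp
qed

lemma adjoint_eq: "adjoint_op T = T"
  using pos unfolding positive_operator_def self_adjoint_def by blast

text \<open>The maximality contained in self-adjointness: it places a vector \<open>y\<close> in the
  domain without assuming it there. Density makes the \<open>THE\<close> in the adjoint pick
  \<open>z\<close>.\<close>

lemma self_adjointD:
  assumes "\<forall>x\<in>dom T. cinner (T \<bullet>\<^sub>o x) y = cinner x z"
  shows "T y = Some z"
proof -
  have "(THE z. \<forall>x\<in>dom T. cinner (T \<bullet>\<^sub>o x) y = cinner x z) = z"
    using assms by (intro the_equality adjoint_unique[OF _ assms])
  moreover have "\<exists>z. \<forall>x\<in>dom T. cinner (T \<bullet>\<^sub>o x) y = cinner x z"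
    using assms by (rule exI)
  ultimately have "adjoint_op T y = Some z"
    by (simp only: adjoint_op_def if_True)
  then show ?thesis
    by (simp only: adjoint_eq)
qed

lemma op_symmetric:
  assumes "x \<in> dom T" "y \<in> dom T"
  shows "cinner (T \<bullet>\<^sub>o x) y = cinner x (T \<bullet>\<^sub>o y)"
proof -
  have "adjoint_op T y \<noteq> None"
    using assms by (simp only: adjoint_eq) blast
  then obtain z where z: "\<forall>x\<in>dom T. cinner (T \<bullet>\<^sub>o x) y = cinner x z"
    unfolding adjoint_op_def by (auto split: if_splits)
  have "T \<bullet>\<^sub>o y = z" by (simp only: self_adjointD[OF z] option.sel)
  then show ?thesis using bspec[OF z assms(1)] by (simp only:)
qed

lemma op_form_nonneg: "x \<in> dom T \<Longrightarrow> 0 \<le> rinner (T \<bullet>\<^sub>o x) x"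
  using pos unfolding positive_operator_def by (simp add: complex_nonneg_Reals_iff)

lemma op_form_of_real:
  "x \<in> dom T \<Longrightarrow> cinner (T \<bullet>\<^sub>o x) x = complex_of_real (rinner (T \<bullet>\<^sub>o x) x)"
  using pos unfolding positive_operator_def
  by (simp add: complex_nonneg_Reals_iff complex_eq_iff)

text \<open>The hypothesis \<open>shift\<close> says that the form of \<open>T - c\<close> is
  positive semidefinite. It is applied with \<open>c = 0\<close> to bound the form from below, and
  then with \<open>c = m(T)\<close>.\<close>

lemma shifted_form_cauchy_schwarz:
  assumes shift: "\<And>v. v \<in> dom T \<Longrightarrow> c * (norm v)\<^sup>2 \<le> rinner (T \<bullet>\<^sub>o v) v"
    and xy: "x \<in> dom T" "y \<in> dom T"
  shows "(rinner (T \<bullet>\<^sub>o x - c *\<^sub>R x) y)\<^sup>2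
    \<le> rinner (T \<bullet>\<^sub>o x - c *\<^sub>R x) x * rinner (T \<bullet>\<^sub>o y - c *\<^sub>R y) y"
proof (rule form_cauchy_schwarz[where D = "dom T" and B = "\<lambda>x y. rinner (T \<bullet>\<^sub>o x - c *\<^sub>R x) y"])
  show "rinner (T \<bullet>\<^sub>o u - c *\<^sub>R u) v = rinner (T \<bullet>\<^sub>o v - c *\<^sub>R v) u"
    if "u \<in> dom T" "v \<in> dom T" for u v
    unfolding rinner_simps op_symmetric[OF that]
    by (subst (1 2) rinner_commute) (rule refl)
  show "rinner (T \<bullet>\<^sub>o (u + v) - c *\<^sub>R (u + v)) w
      = rinner (T \<bullet>\<^sub>o u - c *\<^sub>R u) w + rinner (T \<bullet>\<^sub>o v - c *\<^sub>R v) w"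
    if "u \<in> dom T" "v \<in> dom T" for u v w
    unfolding op_add[OF that] rinner_simps by (simp add: algebra_simps)
  show "rinner (T \<bullet>\<^sub>o (r *\<^sub>R u) - c *\<^sub>R (r *\<^sub>R u)) v = r * rinner (T \<bullet>\<^sub>o u - c *\<^sub>R u) v"
    if "u \<in> dom T" for r u v
    unfolding op_scaleR[OF that] rinner_simps by (simp add: algebra_simps)
  show "0 \<le> rinner (T \<bullet>\<^sub>o u - c *\<^sub>R u) u" if "u \<in> dom T" for u
    unfolding rinner_simps rinner_self using shift[OF that] by simp
qed (fact dom_subspace xy)+

section \<open>The minimum modulus and the lower bound for the form\<close>

lemma min_modulus_le:
  assumes "x \<in> dom T" "norm x = 1"
  shows "min_modulus T \<le> norm (T \<bullet>\<^sub>o x)"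
  unfolding min_modulus_def using assms by (intro cInf_lower bdd_belowI[of _ 0]) auto

text \<open>The unit vector guarantees that the infimum is over a nonempty set.\<close>

lemma min_modulus_nonneg:
  assumes "x \<in> dom T" "norm x = 1"
  shows "0 \<le> min_modulus T"
  unfolding min_modulus_def using assms by (intro cInf_greatest) auto

lemma min_modulus_bound:
  assumes x: "x \<in> dom T"
  shows "min_modulus T * norm x \<le> norm (T \<bullet>\<^sub>o x)"
proof (cases "x = 0")
  case False
  have "min_modulus T \<le> norm (T \<bullet>\<^sub>o ((1 / norm x) *\<^sub>R x))"
    using x False by (intro min_modulus_le subspace_scale[OF dom_subspace]) auto
  then show ?thesis using x False by (simp add: op_scaleR field_simps)
qed simp

text \<open>A vector \<open>z\<close> orthogonal to the range satisfies the adjoint relation with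
  value 0, so it lies in the domain and \<open>T z = Some 0\<close>; the bound
  \<open>m(T) * norm z \<le> 0\<close> then kills it.\<close>

lemma range_dense:
  assumes "0 < min_modulus T"
  shows "closure ((\<lambda>x. T \<bullet>\<^sub>o x) ` dom T) = UNIV"
proof (rule dense_if_orthogonal_trivial)
  let ?R = "(\<lambda>x. T \<bullet>\<^sub>o x) ` dom T"
  show "subspace ?R"
  proof (rule subspaceI)
    show "0 \<in> ?R"
      using op_scaleR[of 0 0] subspace_0[OF dom_subspace] by force
    show "u + v \<in> ?R" if uv: "u \<in> ?R" "v \<in> ?R" for u v
    proof -
      obtain x y where "x \<in> dom T" "y \<in> dom T" "u = T \<bullet>\<^sub>o x" "v = T \<bullet>\<^sub>o y"
        using uv by blast
      then show ?thesis
        using subspace_add[OF dom_subspace] op_add[of x y] by (intro image_eqI[of _ _ "x + y"]) simp_all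
    qed
    show "r *\<^sub>R u \<in> ?R" if u: "u \<in> ?R" for r u
    proof -
      obtain x where "x \<in> dom T" "u = T \<bullet>\<^sub>o x" using u by blast
      then show ?thesis
        using subspace_scale[OF dom_subspace] op_scaleR[of x r] by (intro image_eqI[of _ _ "r *\<^sub>R x"]) simp_all
    qed
  qed
next
  fix z assume z: "\<And>u. u \<in> (\<lambda>x. T \<bullet>\<^sub>o x) ` dom T \<Longrightarrow> rinner u z = 0"
  have "cinner (T \<bullet>\<^sub>o x) z = cinner x 0" if x: "x \<in> dom T" for x
  proof -
    \<comment> \<open>Real orthogonality controls only the real part at \<open>x\<close>; testing at
      \<open>\<i> *\<^sub>C x\<close> gives the imaginary part.\<close>
    have ix: "\<i> *\<^sub>C x \<in> dom T" and "T \<bullet>\<^sub>o (\<i> *\<^sub>C x) = \<i> *\<^sub>C (T \<bullet>\<^sub>o x)"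
      using lin x cvec.subspace_scale unfolding linear_operator_def by blast+
    then have "Im (cinner (T \<bullet>\<^sub>o x) z) = 0"
      using z[OF imageI[OF ix]] by (simp add: cinner_scaleC_left)
    moreover have "Re (cinner (T \<bullet>\<^sub>o x) z) = 0" using z x by blast
    moreover have "cinner x 0 = 0"
      using cinner_scaleC_left[of 0 0 x] cinner_commute[of x 0] by simp
    ultimately show ?thesis by (simp add: complex_eq_iff)
  qed
  then have "T z = Some 0" by (intro self_adjointD) simp
  then have "min_modulus T * norm z \<le> 0"
    using min_modulus_bound[of z] by (simp add: domI)
  then show "z = 0" using assms by (simp add: mult_le_0_iff)
qed

lemma form_ge_min_modulus:
  assumes x: "x \<in> dom T"
  shows "min_modulus T * (norm x)\<^sup>2 \<le> rinner (T \<bullet>\<^sub>o x) x"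
proof (cases "0 < min_modulus T \<and> x \<noteq> 0")
  case False
  then have "min_modulus T * (norm x)\<^sup>2 \<le> 0"
    by (auto simp: mult_le_0_iff)
  then show ?thesis using op_form_nonneg[OF x] by linarith
next
  case True
  define m where "m = min_modulus T"
  have m: "0 < m" using True by (simp add: m_def)
  \<comment> \<open>The preimage \<open>w\<close> of \<open>u\<close> is eliminated here, so that
    both sides are continuous in \<open>u\<close> and the limit \<open>u \<rightarrow> x\<close>
    makes sense.\<close>
  have bound: "m * (rinner u x)\<^sup>2 \<le> (norm u)\<^sup>2 * rinner (T \<bullet>\<^sub>o x) x"
    if u_range: "u \<in> (\<lambda>x. T \<bullet>\<^sub>o x) ` dom T" for u
  proof -
    obtain w where w: "w \<in> dom T" and u: "u = T \<bullet>\<^sub>o w" using u_range by blast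
    have "(rinner u x)\<^sup>2 \<le> rinner u w * rinner (T \<bullet>\<^sub>o x) x"
      using shifted_form_cauchy_schwarz[of 0 w x] w x op_form_nonneg by (simp add: u)
    then have "m * (rinner u x)\<^sup>2 \<le> m * (rinner u w * rinner (T \<bullet>\<^sub>o x) x)"
      using m by (intro mult_left_mono) auto
    also have "\<dots> = (m * rinner u w) * rinner (T \<bullet>\<^sub>o x) x" by simp
    also have "\<dots> \<le> (norm u)\<^sup>2 * rinner (T \<bullet>\<^sub>o x) x"
    proof (rule mult_right_mono[OF _ op_form_nonneg[OF x]])
      have "m * rinner u w \<le> m * (norm u * norm w)"
        using rinner_cauchy_schwarz[of u w] m by (intro mult_left_mono) auto
      also have "\<dots> = norm u * (m * norm w)" by simp
      also have "\<dots> \<le> norm u * norm u"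
        using min_modulus_bound[OF w] by (intro mult_left_mono) (auto simp: u m_def)
      finally show "m * rinner u w \<le> (norm u)\<^sup>2" by (simp add: power2_eq_square)
    qed
    finally show ?thesis .
  qed
  obtain f where f: "\<And>n::nat. f n \<in> (\<lambda>x. T \<bullet>\<^sub>o x) ` dom T" "f \<longlonglongrightarrow> x"
    using range_dense True closure_sequential[of x] by (metis UNIV_I)
  have "m * (rinner x x)\<^sup>2 \<le> (norm x)\<^sup>2 * rinner (T \<bullet>\<^sub>o x) x"
  proof (rule LIMSEQ_le)
    show "(\<lambda>n. m * (rinner (f n) x)\<^sup>2) \<longlonglongrightarrow> m * (rinner x x)\<^sup>2"
      by (intro tendsto_intros tendsto_rinner f)
    show "(\<lambda>n. (norm (f n))\<^sup>2 * rinner (T \<bullet>\<^sub>o x) x) \<longlonglongrightarrow> (norm x)\<^sup>2 * rinner (T \<bullet>\<^sub>o x) x"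
      by (intro tendsto_intros f)
  qed (use bound f in blast)
  \<comment> \<open>One factor \<open>(norm x)\<^sup>2\<close> is split off to be cancelled.\<close>
  then have "(norm x)\<^sup>2 * (m * (norm x)\<^sup>2) \<le> (norm x)\<^sup>2 * rinner (T \<bullet>\<^sub>o x) x"
    by (simp add: rinner_self power2_eq_square mult_ac)
  moreover have "0 < (norm x)\<^sup>2" using True by simp
  ultimately show ?thesis unfolding m_def by (rule mult_left_le_imp_le)
qed

section \<open>Attainment, eigenvalues and extreme points\<close>

lemma point_spectrum_if_attaining:
  assumes "minimum_attaining T"
  shows "complex_of_real (min_modulus T) \<in> point_spectrum T"
proof -
  obtain x where x: "x \<in> dom T" "norm x = 1" "norm (T \<bullet>\<^sub>o x) = min_modulus T"
    using assms unfolding minimum_attaining_def by blast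
  let ?m = "min_modulus T"
  have "?m * ?m \<le> ?m * rinner (T \<bullet>\<^sub>o x) x"
    using form_ge_min_modulus[OF x(1)] x min_modulus_nonneg by (intro mult_left_mono) auto
  \<comment> \<open>Expanding the square gives
    \<open>2 m\<^sup>2 - 2 m \<langle>Tx,x\<rangle>\<close>, with \<open>m = m(T)\<close>.\<close>
  then have "(norm (T \<bullet>\<^sub>o x - ?m *\<^sub>R x))\<^sup>2 \<le> 0"
    unfolding norm_diff_sq rinner_simps norm_scaleR power_mult_distrib using x(2,3)
    by (simp add: power2_eq_square)
  then have "T \<bullet>\<^sub>o x = complex_of_real ?m *\<^sub>C x" by (simp add: scaleR_scaleC)
  moreover have "x \<noteq> 0" using x by auto
  ultimately show ?thesis using x unfolding point_spectrum_def by blast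
qed

lemma unit_eigenvector:
  assumes "complex_of_real r \<in> point_spectrum T"
  obtains x where "x \<in> dom T" "norm x = 1" "T \<bullet>\<^sub>o x = r *\<^sub>R x"
proof -
  obtain v where v: "v \<in> dom T" "v \<noteq> 0" "T \<bullet>\<^sub>o v = r *\<^sub>R v"
    using assms unfolding point_spectrum_def by (auto simp: scaleR_scaleC)
  show ?thesis
  proof (rule that)
    show "(1 / norm v) *\<^sub>R v \<in> dom T" using v subspace_scale[OF dom_subspace] by blast
  qed (use v in \<open>auto simp: op_scaleR\<close>)
qed

lemma attaining_if_point_spectrum:
  assumes "complex_of_real (min_modulus T) \<in> point_spectrum T"
  shows "minimum_attaining T"
proof -
  obtain x where x: "x \<in> dom T" "norm x = 1" "T \<bullet>\<^sub>o x = min_modulus T *\<^sub>R x"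
    using unit_eigenvector[OF assms] .
  then have "norm (T \<bullet>\<^sub>o x) = min_modulus T" using min_modulus_nonneg[OF x(1,2)] by simp
  then show ?thesis using x unfolding minimum_attaining_def by blast
qed

lemma numerical_range_ge:
  assumes "z \<in> numerical_range T"
  obtains r where "z = complex_of_real r" "min_modulus T \<le> r"
proof -
  obtain x where x: "x \<in> dom T" "norm x = 1" "z = cinner (T \<bullet>\<^sub>o x) x"
    using assms unfolding numerical_range_def by blast
  show ?thesis
    using that op_form_of_real[OF x(1)] form_ge_min_modulus[OF x(1)] x by simp
qed

lemma extreme_point_if_point_spectrum:
  assumes "complex_of_real (min_modulus T) \<in> point_spectrum T"
  shows "complex_of_real (min_modulus T) extreme_point_of numerical_range T"
  unfolding extreme_point_of_def
proof (intro conjI ballI notI)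
  let ?m = "min_modulus T"
  obtain x where x: "x \<in> dom T" "norm x = 1" "T \<bullet>\<^sub>o x = ?m *\<^sub>R x"
    using unit_eigenvector[OF assms] .
  have "cinner (T \<bullet>\<^sub>o x) x = complex_of_real ?m"
    using op_form_of_real[OF x(1)] x by (simp add: rinner_simps rinner_self)
  then show "complex_of_real ?m \<in> numerical_range T"
    using x unfolding numerical_range_def by force
next
  let ?m = "min_modulus T"
  fix a b assume ab: "a \<in> numerical_range T" "b \<in> numerical_range T"
    and seg: "complex_of_real ?m \<in> open_segment a b"
  obtain r s where r: "a = complex_of_real r" "?m \<le> r" and s: "b = complex_of_real s" "?m \<le> s"
    using numerical_range_ge ab by metis
  from seg obtain u where u: "0 < u" "u < 1" "a \<noteq> b"
    "complex_of_real ?m = (1 - u) *\<^sub>R a + u *\<^sub>R b"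
    by (auto simp: in_segment)
  then have "?m = (1 - u) * r + u * s"
    using r s by (auto simp: complex_eq_iff)
  \<comment> \<open>A sum of nonnegative terms with positive weights vanishes, so both endpoints
    equal \<open>?m\<close>, against \<open>a \<noteq> b\<close>.\<close>
  then have "(1 - u) * (r - ?m) + u * (s - ?m) = 0" by (simp add: algebra_simps)
  moreover have "0 \<le> (1 - u) * (r - ?m)" "0 \<le> u * (s - ?m)" using r s u by auto
  ultimately have "(1 - u) * (r - ?m) = 0" "u * (s - ?m) = 0" by linarith+
  then have "r = ?m" "s = ?m" using u(1,2) by simp_all
  then show False using u(3) r(1) s(1) by blast
qed

text \<open>Gives the way back from (3) to (2), since an extreme point belongs to the numerical
  range.\<close>

lemma point_spectrum_if_numerical_range:
  assumes "complex_of_real (min_modulus T) \<in> numerical_range T"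
  shows "complex_of_real (min_modulus T) \<in> point_spectrum T"
proof -
  let ?m = "min_modulus T"
  obtain x where x: "x \<in> dom T" "norm x = 1" "complex_of_real ?m = cinner (T \<bullet>\<^sub>o x) x"
    using assms unfolding numerical_range_def by blast
  have "rinner (T \<bullet>\<^sub>o x) x = ?m" using x(3) by (metis Re_complex_of_real)
  then have isotropic: "rinner (T \<bullet>\<^sub>o x - ?m *\<^sub>R x) x = 0"
    using x by (simp add: rinner_simps rinner_self)
  have "T \<bullet>\<^sub>o x - ?m *\<^sub>R x = 0"
  proof (rule eq_zero_if_rinner_zero_on_dense)
    show "closure (dom T) = UNIV" using dense unfolding densely_defined_def .
    fix y assume y: "y \<in> dom T"
    \<comment> \<open>Isotropy of \<open>x\<close> annihilates the right-hand side of
      Cauchy--Schwarz, so \<open>(T - m)x\<close> is orthogonal to the dense domain.\<close>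
    have "(rinner (T \<bullet>\<^sub>o x - ?m *\<^sub>R x) y)\<^sup>2 \<le> 0"
      using shifted_form_cauchy_schwarz[OF form_ge_min_modulus x(1) y] isotropic by simp
    then show "rinner y (T \<bullet>\<^sub>o x - ?m *\<^sub>R x) = 0" by (simp add: rinner_commute[of y])
  qed
  then have "T \<bullet>\<^sub>o x = complex_of_real ?m *\<^sub>C x" by (simp add: scaleR_scaleC)
  moreover have "x \<noteq> 0" using x by auto
  ultimately show ?thesis using x unfolding point_spectrum_def by blast
qed

end

theorem proposition3p11:
  fixes T :: "'a::chilbert_space operator"
  assumes "infinite_dimensional TYPE('a)"
    and "linear_operator T" and "densely_defined T" and "closed_operator T"
    and "positive_operator T"
  shows "(minimum_attaining T \<longleftrightarrow> complex_of_real (min_modulus T) \<in> point_spectrum T) \<and>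
    (complex_of_real (min_modulus T) \<in> point_spectrum T \<longleftrightarrow>
       complex_of_real (min_modulus T) extreme_point_of numerical_range T)"
proof -
  note T = assms(2,3,5)
  show ?thesis
    using point_spectrum_if_attaining[OF T] attaining_if_point_spectrum[OF T]
      extreme_point_if_point_spectrum[OF T] point_spectrum_if_numerical_range[OF T]
    unfolding extreme_point_of_def by blast
qed

end
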